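(* Consider the system $$\frac{dx}{dt}=\frac{\partial H}{\partial y},\quad \frac{dy}{dt}=-\frac{\partial H}{\partial x},\quad \frac{dz}{dt}=\frac{\partial H}{\partial w},\quad \frac{dw}{dt}=-\frac{\partial H}{\partial z},\quad \frac{dq}{dt}=\frac{\partial H}{\partial p},\quad \frac{dp}{dt}=-\frac{\partial H}{\partial q},$$ with $H$ the polynomial Hamiltonian given in the context and parameters satisfying $\alpha_0+\alpha_1+\alpha_2+\alpha_3=1$. This system has the following invariant divisors: - if $\alpha_0=0$, then $f_0:=y+\frac{z^2}{4}$ is an invariant divisor; - if $\alpha_1=0$, then $f_1:=w$ is an invariant divisor; - if $\alpha_2=0$, then $f_2:=w+p+\frac{y}{2}+\frac{xz}{2}-\frac{zq}{4}+t$ is an invariant divisor; - if $\alpha_3=0$, then $f_3:=p$ is an invariant divisor.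
   Context: Here $x,y,z,w,q,p$ are unknown complex variables (functions of $t$), and $\alpha_0,\alpha_1,\alpha_2,\alpha_3$ are complex parameters, constant in $t$, satisfying $\alpha_0+\alpha_1+\alpha_2+\alpha_3=1$. The Hamiltonian is $$\begin{aligned} H=&\frac{1}{4t}y^3+\frac{3}{2}y^2+\frac{3\alpha_3-1}{t}xy+\frac{3}{4t}z^2w^2+\frac{3}{2}z^2w+\frac{3\alpha_1+3\alpha_2-2}{2t}zw+\frac{3}{2}\alpha_1 z\\ &-\frac{4}{t}p^3-6p^2-\frac{3\alpha_1+3\alpha_2+3\alpha_3-2}{t}qp-6tp+\frac{3}{4t}\alpha_1(8xp+2zp+yz)+\frac{6}{t}\alpha_2xp\\ &+\frac{3}{2t}\alpha_3(4xp-yq)+\frac{3}{4t}\big(8xyqp-4zwqp+8xzwp-8x^2yp+2z^2wp+yz^2w\\ &-2yq^2p+8w^2p-4yp^2+4yw^2+4y^2w+8ywp-8xp+8tyw\big). \end{aligned}$$ A polynomial $f\in\mathbb{C}(t)[x,y,z,w,q,p]$ is called an invariant divisor of the system if its total derivative along the system, $$\frac{df}{dt}=\frac{\partial f}{\partial t}+\frac{\partial H}{\partial y}\frac{\partial f}{\partial x}-\frac{\partial H}{\partial x}\frac{\partial f}{\partial y}+\frac{\partial H}{\partial w}\frac{\partial f}{\partial z}-\frac{\partial H}{\partial z}\frac{\partial f}{\partial w}+\frac{\partial H}{\partial p}\frac{\partial f}{\partial q}-\frac{\partial H}{\partial q}\frac{\partial f}{\partial p},$$ is divisible by $f$ in $\mathbb{C}(t)[x,y,z,w,q,p]$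 (so that the hypersurface $f=0$ is invariant under the flow). *)

theory Defs
  imports "HOL-Library.Poly_Mapping" "HOL-Computational_Algebra.Computational_Algebra"
begin

text \<open>
  The field \<open>\<complex>(t)\<close> is the fraction field of the polynomial ring \<open>\<complex>[t]\<close>, and
  \<open>\<complex>(t)[x, y, z, w, q, p]\<close> is the ring of finitely supported maps from exponent vectors to \<open>\<complex>(t)\<close>,
  with the convolution product of \<^theory>\<open>HOL-Library.Poly_Mapping\<close>.
\<close>

type_synonym ratfun = "complex poly fract"

datatype var = Vx | Vy | Vz | Vw | Vq | Vp

type_synonym mpoly = "(var \<Rightarrow>\<^sub>0 nat) \<Rightarrow>\<^sub>0 ratfun"

definition scalar :: "complex \<Rightarrow> ratfun" where
  "scalar c = Fract [:c:] 1"

definition t :: ratfun where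
  "t = Fract [:0, 1:] 1"

text \<open>
  The derivation \<open>d/dt\<close> of \<open>\<complex>(t)\<close>, by the quotient rule. Uniqueness of the described value, i.e.
  independence of the representative, is part of \<open>ratfun_deriv_Fract\<close> below.
\<close>

definition ratfun_deriv :: "ratfun \<Rightarrow> ratfun" where
  "ratfun_deriv r = (THE s. \<exists>a b. b \<noteq> 0 \<and> r = Fract a b \<and>
     s = Fract (pderiv a * b - a * pderiv b) (b * b))"

lemma ratfun_deriv_Fract:
  assumes "b \<noteq> 0"
  shows "ratfun_deriv (Fract a b) = Fract (pderiv a * b - a * pderiv b) (b * b)"
  unfolding ratfun_deriv_def
proof (rule the_equality)
  fix s
  assume "\<exists>c d. d \<noteq> 0 \<and> Fract a b = Fract c d \<and> s = Fract (pderiv c * d - c * pderiv d) (d * d)"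
  then obtain c d where cd: "d \<noteq> 0" "Fract a b = Fract c d"
    and s: "s = Fract (pderiv c * d - c * pderiv d) (d * d)"
    by blast
  have eq: "a * d = c * b"
    using cd assms by (simp add: eq_fract)
  hence "pderiv (a * d) = pderiv (c * b)"
    by simp
  hence D: "a * pderiv d + d * pderiv a = c * pderiv b + b * pderiv c"
    by (simp add: pderiv_mult)
  have "(pderiv a * b - a * pderiv b) * (d * d) - (pderiv c * d - c * pderiv d) * (b * b)
      = b * d * ((a * pderiv d + d * pderiv a) - (c * pderiv b + b * pderiv c))
        - (a * d - c * b) * (d * pderiv b + b * pderiv d)"
    by (simp add: algebra_simps)
  also have "\<dots> = 0"
    using eq D by simp
  finally show "s = Fract (pderiv a * b - a * pderiv b) (b * b)"
    using cd(1) assms by (simp add: s eq_fract)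
qed (use assms in blast)

definition Const :: "ratfun \<Rightarrow> mpoly" where
  "Const c = Poly_Mapping.single 0 c"

definition Var :: "var \<Rightarrow> mpoly" where
  "Var v = Poly_Mapping.single (Poly_Mapping.single v 1) 1"

abbreviation X :: mpoly where "X \<equiv> Var Vx"
abbreviation Y :: mpoly where "Y \<equiv> Var Vy"
abbreviation Z :: mpoly where "Z \<equiv> Var Vz"
abbreviation W :: mpoly where "W \<equiv> Var Vw"
abbreviation Q :: mpoly where "Q \<equiv> Var Vq"
abbreviation P :: mpoly where "P \<equiv> Var Vp"

text \<open>
  Formal partial derivative with respect to \<open>v\<close>. The subtraction of exponents is truncated, which is
  harmless: monomials not containing \<open>v\<close> get the coefficient \<open>0\<close>.
\<close>

definition partial :: "var \<Rightarrow> mpoly \<Rightarrow> mpoly" where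
  "partial v f = (\<Sum>m\<in>Poly_Mapping.keys f.
     Poly_Mapping.single (m - Poly_Mapping.single v 1)
       (of_nat (Poly_Mapping.lookup m v) * Poly_Mapping.lookup f m))"

text \<open>\<open>\<partial>f/\<partial>t\<close>: differentiates the coefficients only, treating the six variables as independent of \<open>t\<close>.\<close>

definition partial_t :: "mpoly \<Rightarrow> mpoly" where
  "partial_t f = Poly_Mapping.map ratfun_deriv f"

text \<open>
  Total derivative along the system with Hamiltonian \<open>H\<close> and canonically conjugate pairs
  \<open>(x, y)\<close>, \<open>(z, w)\<close>, \<open>(q, p)\<close>.
\<close>

definition total_deriv :: "mpoly \<Rightarrow> mpoly \<Rightarrow> mpoly" where
  "total_deriv H f = partial_t f
     + partial Vy H * partial Vx f - partial Vx H * partial Vy f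
     + partial Vw H * partial Vz f - partial Vz H * partial Vw f
     + partial Vp H * partial Vq f - partial Vq H * partial Vp f"

definition invariant_divisor :: "mpoly \<Rightarrow> mpoly \<Rightarrow> bool" where
  "invariant_divisor H f \<longleftrightarrow> f dvd total_deriv H f"

text \<open>The Hamiltonian depends on \<open>\<alpha>\<^sub>1\<close>, \<open>\<alpha>\<^sub>2\<close>, \<open>\<alpha>\<^sub>3\<close> only; \<open>\<alpha>\<^sub>0\<close> is determined by the normalisation.\<close>

definition Ham :: "complex \<Rightarrow> complex \<Rightarrow> complex \<Rightarrow> mpoly" where
  "Ham \<alpha>\<^sub>1 \<alpha>\<^sub>2 \<alpha>\<^sub>3 =
     Const (1 / (4 * t)) * Y^3 + Const (3 / 2) * Y^2
     + Const (scalar (3 * \<alpha>\<^sub>3 - 1) / t) * X * Y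
     + Const (3 / (4 * t)) * Z^2 * W^2 + Const (3 / 2) * Z^2 * W
     + Const (scalar (3 * \<alpha>\<^sub>1 + 3 * \<alpha>\<^sub>2 - 2) / (2 * t)) * Z * W
     + Const (3 / 2 * scalar \<alpha>\<^sub>1) * Z
     - Const (4 / t) * P^3 - 6 * P^2
     - Const (scalar (3 * \<alpha>\<^sub>1 + 3 * \<alpha>\<^sub>2 + 3 * \<alpha>\<^sub>3 - 2) / t) * Q * P
     - 6 * Const t * P
     + Const (3 / (4 * t) * scalar \<alpha>\<^sub>1) * (8 * X * P + 2 * Z * P + Y * Z)
     + Const (6 / t * scalar \<alpha>\<^sub>2) * X * P
     + Const (3 / (2 * t) * scalar \<alpha>\<^sub>3) * (4 * X * P - Y * Q)
     + Const (3 / (4 * t)) *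
       (8 * X * Y * Q * P - 4 * Z * W * Q * P + 8 * X * Z * W * P - 8 * X^2 * Y * P
        + 2 * Z^2 * W * P + Y * Z^2 * W
        - 2 * Y * Q^2 * P + 8 * W^2 * P - 4 * Y * P^2 + 4 * Y * W^2 + 4 * Y^2 * W
        + 8 * Y * W * P - 8 * X * P + 8 * Const t * Y * W)"

end

theory Submission
  imports Defs
begin

text \<open>
  Put \<open>{G, f} = \<Sum> (\<partial>G/\<partial>p\<^sub>i \<partial>f/\<partial>q\<^sub>i - \<partial>G/\<partial>q\<^sub>i \<partial>f/\<partial>p\<^sub>i)\<close>, so that the total derivative of \<open>f\<close> along the
  system is \<open>\<partial>f/\<partial>t + {H, f}\<close>. Divisibility is then witnessed by an explicit cofactor, found by
  dividing \<open>\<partial>f/\<partial>t + {H, f}\<close> by \<open>f\<close> as a polynomial in \<open>y\<close>, in \<open>w\<close>, or in \<open>p\<close>: each divisor is linear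
  with a constant leading coefficient in one of these variables, and the remainder vanishes
  because of the condition on the parameters.

  Two facts turn this into a computation. The formal operators \<open>\<partial>/\<partial>v\<close> and \<open>\<partial>/\<partial>t\<close> obey the Leibniz
  rule (lemma \<open>derivationI_single\<close>), so derivatives of the given polynomials
  can be read off their expressions instead of their supports. And being an invariant divisor
  is insensitive to multiplying \<open>f\<close> by a nonzero constant; as \<open>H\<close> and all four divisors become
  polynomials with integer coefficients in the variables, \<open>t\<close>, \<open>1/t\<close> and the parameters once they
  are multiplied by \<open>4\<close> (lemmas \<open>Ham_eq_scaled\<close> and \<open>invariant_divisor_scaledI\<close>), the cofactor
  identities \<open>bracket_f0\<close> to \<open>bracket_f3\<close> involve no fractions and hold by expansion in a
  commutative ring. Only \<open>f\<^sub>2\<close> depends on \<open>t\<close>; there \<open>t \<cdot> 1/t = 1\<close> is needed as well.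
\<close>

section \<open>Derivations\<close>

locale derivation =
  fixes D :: "'a::comm_ring_1 \<Rightarrow> 'a"
  assumes add: "D (f + g) = D f + D g"
    and mult: "D (f * g) = D f * g + f * D g"
begin

lemma zero: "D 0 = 0"
  using add[of 0 0] by simp

lemma one: "D 1 = 0"
  using mult[of 1 1] by simp

lemma minus: "D (- f) = - D f"
proof -
  have "D f + D (- f) = 0"
    using add[of f "- f"] zero by simp
  thus ?thesis
    by (simp add: add_eq_0_iff)
qed

lemma diff: "D (f - g) = D f - D g"
  using add[of f "- g"] by (simp add: minus)

lemma numeral: "D (numeral n) = 0"
  by (induction n) (simp_all only: numeral.simps add one add_0)

lemma power2: "D (f\<^sup>2) = 2 * f * D f"
  by (simp add: power2_eq_square mult)

lemma power3: "D (f ^ 3) = 3 * f\<^sup>2 * D f"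
  by (simp add: power3_eq_cube power2_eq_square mult algebra_simps)

lemmas rules = zero one numeral add minus diff mult power2 power3

end

text \<open>
  Every polynomial is a sum of monomials, and both sides of the Leibniz rule are biadditive, so
  products of two monomials decide it.
\<close>

lemma derivationI_single:
  fixes D :: "('a::comm_monoid_add \<Rightarrow>\<^sub>0 'b::comm_ring_1) \<Rightarrow> 'a \<Rightarrow>\<^sub>0 'b"
  assumes add: "\<And>f g. D (f + g) = D f + D g"
    and single: "\<And>m n a b. D (Poly_Mapping.single m a * Poly_Mapping.single n b)
      = D (Poly_Mapping.single m a) * Poly_Mapping.single n b
        + Poly_Mapping.single m a * D (Poly_Mapping.single n b)"
  shows "derivation D"
proof
  have zero: "D 0 = 0"
    using add[of 0 0] by simp
  \<comment> \<open>So induction over updates adds one monomial at a time.\<close>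
  have update: "Poly_Mapping.update m a f = Poly_Mapping.single m a + f"
    if "m \<notin> Poly_Mapping.keys f" for m a and f :: "'a \<Rightarrow>\<^sub>0 'b"
    using that
    by (intro poly_mapping_eqI)
      (auto simp: lookup_update lookup_add lookup_single in_keys_iff when_def)
  have single_left: "D (Poly_Mapping.single m a * g)
      = D (Poly_Mapping.single m a) * g + Poly_Mapping.single m a * D g" for m a g
    by (induction g rule: update_induct)
      (simp_all add: zero update add single algebra_simps)
  show "D (f * g) = D f * g + f * D g" for f g
    by (induction f rule: update_induct)
      (simp_all add: zero update add single_left distrib_left distrib_right add_ac)
qed (rule add)

section \<open>The differential operators are derivations\<close>

lemma partial_single:
  "partial v (Poly_Mapping.single m a)
    = Poly_Mapping.single (m - Poly_Mapping.single v 1) (of_nat (Poly_Mapping.lookup m v) * a)"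
  by (cases "a = 0") (simp_all add: partial_def)

lemma partial_add: "partial v (f + g) = partial v f + partial v g"
  unfolding partial_def
  by (rule setsum_keys_plus_distrib) (simp_all add: distrib_left single_add)

text \<open>
  Exponent subtraction is truncated, hence associates with addition only when it does not truncate.
  In the Leibniz rule for \<open>partial\<close>, the truncating case carries the coefficient \<open>0\<close>.
\<close>

lemma single_diff_add:
  fixes m n :: "'a \<Rightarrow>\<^sub>0 nat"
  assumes "Poly_Mapping.lookup m v \<noteq> 0"
  shows "m - Poly_Mapping.single v 1 + n = m + n - Poly_Mapping.single v 1"
  using assms
  by (intro poly_mapping_eqI)
    (auto simp: lookup_add lookup_minus lookup_single when_def)

lemma partial_single_mult:
  "partial v (Poly_Mapping.single m a * Poly_Mapping.single n b)
    = partial v (Poly_Mapping.single m a) * Poly_Mapping.single n b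
      + Poly_Mapping.single m a * partial v (Poly_Mapping.single n b)"
proof -
  let ?e = "Poly_Mapping.single v (1::nat)"
  let ?l = "\<lambda>k. of_nat (Poly_Mapping.lookup k v)"
  have left: "Poly_Mapping.single (m - ?e + n) (?l m * a * b)
      = Poly_Mapping.single (m + n - ?e) (?l m * a * b)"
    using single_diff_add[of m v n] by (cases "Poly_Mapping.lookup m v = 0") auto
  have right: "Poly_Mapping.single (m + (n - ?e)) (a * (?l n * b))
      = Poly_Mapping.single (m + n - ?e) (a * (?l n * b))"
    using single_diff_add[of n v m]
    by (cases "Poly_Mapping.lookup n v = 0") (auto simp: add.commute)
  show ?thesis
    unfolding partial_single mult_single left right
    by (simp add: lookup_add algebra_simps flip: single_add)
qed

interpretation partial: derivation "partial v" for v
  by (rule derivationI_single) (rule partial_add partial_single_mult)+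

interpretation ratfun_deriv: derivation ratfun_deriv
proof
  fix f g :: ratfun
  obtain a b where f: "f = Fract a b" "b \<noteq> 0"
    by (cases f)
  obtain c d where g: "g = Fract c d" "d \<noteq> 0"
    by (cases g)
  show "ratfun_deriv (f + g) = ratfun_deriv f + ratfun_deriv g"
    using f g by (simp add: ratfun_deriv_Fract eq_fract pderiv_add pderiv_mult algebra_simps)
  show "ratfun_deriv (f * g) = ratfun_deriv f * g + f * ratfun_deriv g"
    using f g by (simp add: ratfun_deriv_Fract eq_fract pderiv_mult algebra_simps)
qed

lemma partial_t_single:
  "partial_t (Poly_Mapping.single m a) = Poly_Mapping.single m (ratfun_deriv a)"
  by (simp add: partial_t_def ratfun_deriv.zero)

lemma lookup_partial_t:
  "Poly_Mapping.lookup (partial_t f) m = ratfun_deriv (Poly_Mapping.lookup f m)"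
  by (simp add: partial_t_def Poly_Mapping.map.rep_eq when_def ratfun_deriv.zero)

interpretation partial_t: derivation partial_t
proof (rule derivationI_single)
  show "partial_t (f + g) = partial_t f + partial_t g" for f g
    by (intro poly_mapping_eqI) (simp add: lookup_partial_t lookup_add ratfun_deriv.add)
  show "partial_t (Poly_Mapping.single m a * Poly_Mapping.single n b)
      = partial_t (Poly_Mapping.single m a) * Poly_Mapping.single n b
        + Poly_Mapping.single m a * partial_t (Poly_Mapping.single n b)" for m n a b
    by (simp add: mult_single partial_t_single ratfun_deriv.mult single_add)
qed

section \<open>Constants and variables\<close>

lemma partial_Var: "partial v (Var u) = (if u = v then 1 else 0)"
  by (simp add: Var_def partial_single lookup_single when_def)

lemma partial_Const: "partial v (Const c) = 0"
  by (simp add: Const_def partial_single)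

lemma partial_t_Var: "partial_t (Var v) = 0"
  by (simp add: Var_def partial_t_single ratfun_deriv.one)

lemma partial_t_Const: "partial_t (Const c) = Const (ratfun_deriv c)"
  by (simp add: Const_def partial_t_single)

lemma ratfun_deriv_t: "ratfun_deriv t = 1"
  by (simp add: t_def ratfun_deriv_Fract One_fract_def pderiv_pCons one_pCons)

lemma Const_rules:
  "Const 0 = 0" "Const 1 = 1" "Const (numeral n) = numeral n"
  "Const (a + b) = Const a + Const b" "Const (a - b) = Const a - Const b"
  "Const (a * b) = Const a * Const b"
  by (simp_all add: Const_def single_add single_diff mult_single)

lemma numeral_fract: "(numeral n :: 'a::idom fract) = Fract (numeral n) 1"
  using of_nat_fract[of "numeral n", where 'a='a] by simp

lemma numeral_ratfun_neq_0: "(numeral n :: ratfun) \<noteq> 0"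
  by (simp add: numeral_fract Zero_fract_def eq_fract)

lemma scalar_rules:
  "scalar (a + b) = scalar a + scalar b" "scalar (a - b) = scalar a - scalar b"
  "scalar (a * b) = scalar a * scalar b" "scalar 0 = 0" "scalar 1 = 1"
  "scalar (numeral n) = numeral n"
  by (simp_all add: scalar_def fract_collapse numeral_fract)
    (simp_all add: numeral_poly fract_collapse mult.commute flip: one_pCons)

lemma t_neq_0: "t \<noteq> 0"
  by (simp add: t_def Zero_fract_def eq_fract)

lemma inverse_t_mult_t: "Const (inverse t) * Const t = 1"
  using t_neq_0 by (simp add: Const_rules flip: Const_rules(6))

lemma four_mult_quarter: "4 * Const (1 / 4) = 1"
  using numeral_ratfun_neq_0 by (simp add: Const_rules flip: Const_rules(3,6))

section \<open>Clearing denominators\<close>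

definition poisson_bracket :: "mpoly \<Rightarrow> mpoly \<Rightarrow> mpoly" where
  "poisson_bracket G f =
     partial Vy G * partial Vx f - partial Vx G * partial Vy f
     + partial Vw G * partial Vz f - partial Vz G * partial Vw f
     + partial Vp G * partial Vq f - partial Vq G * partial Vp f"

text \<open>
  Here \<open>G\<close> plays the role of \<open>4 H\<close>, which puts the factor \<open>4\<close> on \<open>\<partial>f/\<partial>t\<close> and makes a quarter of
  \<open>K\<close> the cofactor. As \<open>c\<close> is constant in \<open>t\<close>, it passes through \<open>\<partial>/\<partial>t\<close> and so does not affect the cofactor.
\<close>

lemma invariant_divisor_scaledI:
  assumes "ratfun_deriv c = 0"
    and "4 * partial_t f + poisson_bracket G f = f * K"
  shows "invariant_divisor (Const (1 / 4) * G) (Const c * f)"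
proof -
  let ?h = "Const (1 / 4)"
  have "total_deriv (?h * G) (Const c * f) = Const c * (partial_t f + ?h * poisson_bracket G f)"
    using assms(1)
    by (simp add: total_deriv_def poisson_bracket_def partial.mult partial_Const
        partial_t.mult partial_t_Const Const_rules algebra_simps)
  also have "partial_t f + ?h * poisson_bracket G f
      = (4 * ?h) * partial_t f + ?h * poisson_bracket G f"
    by (simp only: four_mult_quarter mult_1)
  also have "\<dots> = f * (?h * K)"
    using arg_cong[OF assms(2), of "\<lambda>u. ?h * u"] by (simp add: algebra_simps)
  finally show ?thesis
    unfolding invariant_divisor_def by (metis dvd_triv_left mult.assoc)
qed

text \<open>
  Four times the Hamiltonian, with \<open>t \<cdot> 1/t\<close> already cancelled in the term \<open>24 y w\<close>.
\<close>

definition four_Ham :: "complex \<Rightarrow> complex \<Rightarrow> complex \<Rightarrow> mpoly" where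
  "four_Ham \<alpha>\<^sub>1 \<alpha>\<^sub>2 \<alpha>\<^sub>3 =
     (let A = Const (scalar \<alpha>\<^sub>1); B = Const (scalar \<alpha>\<^sub>2); C = Const (scalar \<alpha>\<^sub>3);
          T = Const (inverse t)
      in T * Y^3 + 6 * Y^2 + 4 * (3 * C - 1) * T * X * Y
         + 3 * T * Z^2 * W^2 + 6 * Z^2 * W + 2 * (3 * A + 3 * B - 2) * T * Z * W
         + 6 * A * Z - 16 * T * P^3 - 24 * P^2
         - 4 * (3 * A + 3 * B + 3 * C - 2) * T * Q * P - 24 * Const t * P
         + 3 * T * A * (8 * X * P + 2 * Z * P + Y * Z) + 24 * T * B * X * P
         + 6 * T * C * (4 * X * P - Y * Q)
         + 3 * T *
           (8 * X * Y * Q * P - 4 * Z * W * Q * P + 8 * X * Z * W * P - 8 * X^2 * Y * P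
            + 2 * Z^2 * W * P + Y * Z^2 * W
            - 2 * Y * Q^2 * P + 8 * W^2 * P - 4 * Y * P^2 + 4 * Y * W^2 + 4 * Y^2 * W
            + 8 * Y * W * P - 8 * X * P)
         + 24 * Y * W)"

lemma Ham_eq_scaled: "Ham \<alpha>\<^sub>1 \<alpha>\<^sub>2 \<alpha>\<^sub>3 = Const (1 / 4) * four_Ham \<alpha>\<^sub>1 \<alpha>\<^sub>2 \<alpha>\<^sub>3"
proof -
  note [simp] = numeral_ratfun_neq_0 t_neq_0
  have coeffs: "1 / (4 * t) = (1 / 4) * inverse t" "3 / 2 = 6 * (1 / 4 :: ratfun)"
    "s / t = s * inverse t" "3 / (4 * t) = 3 * (1 / 4) * inverse t"
    "(s - 2) / (2 * t) = 2 * (1 / 4) * (s - 2) * inverse t"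
    "3 / (2 * t) = 6 * (1 / 4) * inverse t" for s
    by (simp_all add: field_simps)
  let ?h = "Const (1 / 4)" and ?T = "Const (inverse t)"
  let ?A = "Const (scalar \<alpha>\<^sub>1)" and ?B = "Const (scalar \<alpha>\<^sub>2)" and ?C = "Const (scalar \<alpha>\<^sub>3)"
  \<comment> \<open>An identity even if \<open>1/4\<close> and \<open>1/t\<close> are treated as further indeterminates: the last two summands collect the terms in which these meet \<open>4\<close> and \<open>t\<close>.\<close>
  have "Ham \<alpha>\<^sub>1 \<alpha>\<^sub>2 \<alpha>\<^sub>3 = ?h * four_Ham \<alpha>\<^sub>1 \<alpha>\<^sub>2 \<alpha>\<^sub>3
      + (1 - 4 * ?h) * ((3 * ?C - 1) * ?T * X * Y - 4 * ?T * P^3 - 6 * P^2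
          - (3 * ?A + 3 * ?B + 3 * ?C - 2) * ?T * Q * P - 6 * Const t * P + 6 * ?T * ?B * X * P)
      - 24 * ?h * (1 - ?T * Const t) * Y * W"
    unfolding Ham_def four_Ham_def Let_def coeffs scalar_rules Const_rules
    by (simp add: algebra_simps)
  thus ?thesis
    by (simp only: four_mult_quarter inverse_t_mult_t) simp
qed

section \<open>The cofactors\<close>

lemmas derivative_rules =
  partial.rules partial_Var partial_Const partial_t.rules partial_t_Var partial_t_Const
  ratfun_deriv_t

text \<open>
  The second factors below are four times the cofactors in the divisibility of the total derivatives.
\<close>

lemma bracket_f0:
  assumes "a + b + c = 1"
  shows "poisson_bracket (four_Ham a b c) (4 * Y + Z\<^sup>2) = (4 * Y + Z\<^sup>2) *
    (Const (inverse t) * (6 * Y * Z - 12 * Const (scalar c) + 4 - 24 * Q * P + 48 * X * P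
       + 12 * Z * W + 12 * Z * P) + 12 * Z)"
proof -
  have a: "a = 1 - b - c"
    using assms by (simp add: algebra_simps)
  show ?thesis
    unfolding poisson_bracket_def four_Ham_def Let_def a
    by (simp add: derivative_rules scalar_rules Const_rules algebra_simps
        power2_eq_square power3_eq_cube)
qed

lemma bracket_f1:
  "poisson_bracket (four_Ham 0 b c) W = W *
    (Const (inverse t) * (4 - 6 * Y * Z - 6 * Z * W - 6 * Const (scalar b) + 12 * Q * P
       - 24 * X * P - 12 * Z * P) - 12 * Z)"
  unfolding poisson_bracket_def four_Ham_def Let_def
  by (simp add: derivative_rules scalar_rules Const_rules algebra_simps
      power2_eq_square power3_eq_cube)

text \<open>
  The summand \<open>16\<close> is \<open>4 \<partial>F/\<partial>t\<close>, for \<open>F\<close> four times the divisor.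
\<close>

lemma bracket_f2:
  fixes a c
  defines "F \<equiv> 4 * W + 4 * P + 2 * Y + 2 * X * Z - Z * Q + 4 * Const t"
  shows "16 + poisson_bracket (four_Ham a 0 c) F = F *
    (Const (inverse t) * (4 - 6 * Z * W + 12 * X * Y - 6 * Y * Q - 6 * Const (scalar a)
       + 6 * Z * P + 3 * Y * Z) + 6 * Z)" (is "_ = F * (?T * ?E + 6 * Z)")
proof -
  \<comment> \<open>The last summand is the defect of treating \<open>t\<close> and \<open>1/t\<close> as independent: in the product on
    the right, \<open>4 t \<cdot> 1/t\<close> meets the factor \<open>?E\<close>.\<close>
  have "16 + poisson_bracket (four_Ham a 0 c) F
      = F * (?T * ?E + 6 * Z) + 4 * (1 - ?T * Const t) * ?E"
    unfolding poisson_bracket_def four_Ham_def Let_def F_def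
    by (simp add: derivative_rules scalar_rules Const_rules algebra_simps
        power2_eq_square power3_eq_cube)
  thus ?thesis
    by (simp add: inverse_t_mult_t)
qed

lemma bracket_f3:
  "poisson_bracket (four_Ham a b 0) P = P *
    (Const (inverse t) * (12 * Const (scalar a) + 12 * Const (scalar b) - 8 - 24 * X * Y
       + 12 * Z * W + 12 * Y * Q))"
  unfolding poisson_bracket_def four_Ham_def Let_def
  by (simp add: derivative_rules scalar_rules Const_rules algebra_simps
      power2_eq_square power3_eq_cube)

theorem proposition3p2:
  fixes \<alpha>\<^sub>0 \<alpha>\<^sub>1 \<alpha>\<^sub>2 \<alpha>\<^sub>3 :: complex
  assumes "\<alpha>\<^sub>0 + \<alpha>\<^sub>1 + \<alpha>\<^sub>2 + \<alpha>\<^sub>3 = 1"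
  shows "(\<alpha>\<^sub>0 = 0 \<longrightarrow>
            invariant_divisor (Ham \<alpha>\<^sub>1 \<alpha>\<^sub>2 \<alpha>\<^sub>3) (Y + Const (1 / 4) * Z^2)) \<and>
         (\<alpha>\<^sub>1 = 0 \<longrightarrow> invariant_divisor (Ham \<alpha>\<^sub>1 \<alpha>\<^sub>2 \<alpha>\<^sub>3) W) \<and>
         (\<alpha>\<^sub>2 = 0 \<longrightarrow>
            invariant_divisor (Ham \<alpha>\<^sub>1 \<alpha>\<^sub>2 \<alpha>\<^sub>3)
              (W + P + Const (1 / 2) * Y + Const (1 / 2) * X * Z - Const (1 / 4) * Z * Q + Const t)) \<and>
         (\<alpha>\<^sub>3 = 0 \<longrightarrow> invariant_divisor (Ham \<alpha>\<^sub>1 \<alpha>\<^sub>2 \<alpha>\<^sub>3) P)"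
proof (intro conjI impI)
  let ?h = "Const (1 / 4)"
  have quarter: "?h * (4 * f) = f" for f
    using arg_cong[OF four_mult_quarter, of "\<lambda>u. u * f"] by (simp add: ac_simps)
  have half: "Const (1 / 2) = 2 * ?h"
  proof -
    have "1 / 2 = 2 * (1 / 4 :: ratfun)"
      by (simp add: field_simps numeral_ratfun_neq_0)
    thus ?thesis
      by (simp only: Const_rules)
  qed
  have h_const: "ratfun_deriv (1 / 4) = 0"
    using ratfun_deriv.mult[of 4 "1 / 4"]
    by (simp add: numeral_ratfun_neq_0 ratfun_deriv.one ratfun_deriv.numeral)
  {
    assume "\<alpha>\<^sub>0 = 0"
    hence "invariant_divisor (Ham \<alpha>\<^sub>1 \<alpha>\<^sub>2 \<alpha>\<^sub>3) (?h * (4 * Y + Z\<^sup>2))"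
      unfolding Ham_eq_scaled using assms
      by (intro invariant_divisor_scaledI[OF h_const])
        (auto simp: derivative_rules intro!: bracket_f0)
    thus "invariant_divisor (Ham \<alpha>\<^sub>1 \<alpha>\<^sub>2 \<alpha>\<^sub>3) (Y + Const (1 / 4) * Z^2)"
      by (simp add: distrib_left quarter)
  next
    assume "\<alpha>\<^sub>1 = 0"
    hence "invariant_divisor (Ham \<alpha>\<^sub>1 \<alpha>\<^sub>2 \<alpha>\<^sub>3) (Const 1 * W)"
      unfolding Ham_eq_scaled
      by (intro invariant_divisor_scaledI[OF ratfun_deriv.one])
        (auto simp: derivative_rules intro!: bracket_f1)
    thus "invariant_divisor (Ham \<alpha>\<^sub>1 \<alpha>\<^sub>2 \<alpha>\<^sub>3) W"
      by (simp add: Const_rules)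
  next
    assume "\<alpha>\<^sub>2 = 0"
    hence "invariant_divisor (Ham \<alpha>\<^sub>1 \<alpha>\<^sub>2 \<alpha>\<^sub>3)
        (?h * (4 * W + 4 * P + 2 * Y + 2 * X * Z - Z * Q + 4 * Const t))"
      unfolding Ham_eq_scaled
      by (intro invariant_divisor_scaledI[OF h_const])
        (auto simp: derivative_rules Const_rules intro!: bracket_f2)
    also have "?h * (4 * W + 4 * P + 2 * Y + 2 * X * Z - Z * Q + 4 * Const t) =
      W + P + Const (1 / 2) * Y + Const (1 / 2) * X * Z - Const (1 / 4) * Z * Q + Const t"
      by (simp add: distrib_left right_diff_distrib four_mult_quarter half ac_simps)
    finally show "invariant_divisor (Ham \<alpha>\<^sub>1 \<alpha>\<^sub>2 \<alpha>\<^sub>3)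
      (W + P + Const (1 / 2) * Y + Const (1 / 2) * X * Z - Const (1 / 4) * Z * Q + Const t)" .
  next
    assume "\<alpha>\<^sub>3 = 0"
    hence "invariant_divisor (Ham \<alpha>\<^sub>1 \<alpha>\<^sub>2 \<alpha>\<^sub>3) (Const 1 * P)"
      unfolding Ham_eq_scaled
      by (intro invariant_divisor_scaledI[OF ratfun_deriv.one])
        (auto simp: derivative_rules intro!: bracket_f3)
    thus "invariant_divisor (Ham \<alpha>\<^sub>1 \<alpha>\<^sub>2 \<alpha>\<^sub>3) P"
      by (simp add: Const_rules)
  }
qed

end
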